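(* Let $A=\begin{pmatrix} a & b\\ c& d\end{pmatrix}$ be a $2\times 2$ $q$-quantum matrix with quantum adjoint matrix $$\hat{A}=\begin{pmatrix}\hat a&\hat b\\ \hat c&\hat d\end{pmatrix}=\begin{pmatrix} d & -q^{-1}b\\ -qc & a\end{pmatrix}.$$ Let $\delta=ad-qbc$, put $\tau=q^{1/2}a+q^{-1/2}d$ and $\tau'=q^{-1/2}a+q^{1/2}d$, and write $A^m=\begin{pmatrix} a_m & b_m\\ c_m & d_m\end{pmatrix}$ and $\hat A^m=\begin{pmatrix} \hat a_m & \hat b_m\\ \hat c_m & \hat d_m\end{pmatrix}$. Then for every positive integer $m$, \begin{align*} \hat a_{m}&=q^{\frac{m-1}{2}}\hat a f_{m-1}(\tau)-q^{\frac{m}{2}}\delta f_{m-2}(\tau)=q^{-\frac{m-1}{2}}f_{m-1}(\tau')\hat a-q^{-\frac{m}{2}}\delta f_{m-2}(\tau')=d_m,\\ \hat b_{m}&=q^{-\frac{m-1}{2}}\hat b f_{m-1}(\tau)=q^{-\frac{m-1}{2}}f_{m-1}(\tau')\hat b=-q^{-m}b_m,\\ \hat c_{m}&=q^{\frac{m-1}{2}}\hat c f_{m-1}(\tau)=q^{\frac{m-1}{2}}f_{m-1}(\tau')\hat c=-q^{m}c_m,\\ \hat d_{m}&=q^{-\frac{m-1}{2}}\hat d f_{m-1}(\tau)-q^{-\frac{m}{2}}\delta f_{m-2}(\tau)=q^{\frac{m-1}{2}}f_{m-1}(\tau')\hat d-q^{\frac{m}{2}}\delta f_{m-2}(\tau')=a_m.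 \end{align*}
   Context: Let $k$ be a fixed base field and let $q$ be a central indeterminate, with a central invertible square root $q^{1/2}$ (inverse $q^{-1/2}$) adjoined. A $2\times 2$ ($q$-)quantum matrix is a matrix $A=\begin{pmatrix} a & b\\ c& d\end{pmatrix}$ whose entries satisfy the relations $$ab=qba,\quad ac=qca,\quad ad-da=(q-q^{-1})bc,\quad bc=cb,\quad bd=qdb,\quad cd=qdc.$$ The ambient (noncommutative) algebra is $\mathcal{A}_q(Mat(2))$, the algebra generated by $a,b,c,d$ and $q$ with these relations (with $q^{\pm 1/2}$ adjoined). The quantum determinant is $\delta=ad-qbc=da-q^{-1}bc$, which is a central element of this algebra. For an element $x$ of the algebra, set $f_{-1}(x)=0$ and, for $n\ge 0$, $$f_{n}(x)=f_n(x,\delta)=\sum_{l=0}^{\lfloor n/2\rfloor}(-1)^{l}\binom{n-l}{l}x^{n-2l}\delta^{l}.$$ *)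

theory Defs
  imports Complex_Main "Jordan_Normal_Form.Matrix"
begin

section \<open>Quantum matrices over an algebra\<close>

locale unital_algebra = vector_space scale
  for scale :: "'k::field \<Rightarrow> 'r::ring_1 \<Rightarrow> 'r" +
  assumes scale_mult_left: "scale r x * y = scale r (x * y)"
    and scale_mult_right: "x * scale r y = scale r (x * y)"

text \<open>
  The algebra contains a central unit \<open>s\<close> with inverse \<open>t\<close>, playing the roles of \<open>q\<^sup>1\<^sup>/\<^sup>2\<close> and
  \<open>q\<^sup>-\<^sup>1\<^sup>/\<^sup>2\<close>. Accordingly \<open>q = s\<^sup>2\<close>, \<open>q\<^sup>-\<^sup>1 = t\<^sup>2\<close>, and for a natural number \<open>n\<close> the half-integer
  powers \<open>q\<^sup>n\<^sup>/\<^sup>2\<close> and \<open>q\<^sup>-\<^sup>n\<^sup>/\<^sup>2\<close> are \<open>s ^ n\<close> and \<open>t ^ n\<close>.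
\<close>

definition central_unit :: "'r::ring_1 \<Rightarrow> 'r \<Rightarrow> bool" where
  "central_unit s t \<longleftrightarrow> s * t = 1 \<and> t * s = 1 \<and> (\<forall>x. s * x = x * s) \<and> (\<forall>x. t * x = x * t)"

definition mat2 :: "'r \<Rightarrow> 'r \<Rightarrow> 'r \<Rightarrow> 'r \<Rightarrow> 'r mat" where
  "mat2 a b c d = mat_of_rows_list 2 [[a, b], [c, d]]"

text \<open>The parameter \<open>q'\<close> stands for \<open>q\<^sup>-\<^sup>1\<close>.\<close>

definition quantum_matrix :: "'r::ring_1 \<Rightarrow> 'r \<Rightarrow> 'r mat \<Rightarrow> bool" where
  "quantum_matrix q q' A \<longleftrightarrow>
     (\<exists>a b c d. A = mat2 a b c d \<and>
        a * b = q * b * a \<and> a * c = q * c * a \<and> a * d - d * a = (q - q') * b * c \<and>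
        b * c = c * b \<and> b * d = q * d * b \<and> c * d = q * d * c)"

text \<open>
  The index is an integer, so that \<open>f\<^sub>-\<^sub>1 = 0\<close>. The second argument is \<open>\<delta>\<close>.
\<close>

definition qf :: "int \<Rightarrow> 'r::ring_1 \<Rightarrow> 'r \<Rightarrow> 'r" where
  "qf n x \<delta> =
     (if n < 0 then 0
      else (\<Sum>l = 0..nat n div 2.
              (-1) ^ l * of_nat ((nat n - l) choose l) * x ^ (nat n - 2 * l) * \<delta> ^ l))"

lemma mat2_index [simp]:
  "mat2 a b c d $$ (0, 0) = a" "mat2 a b c d $$ (0, 1) = b"
  "mat2 a b c d $$ (1, 0) = c" "mat2 a b c d $$ (1, 1) = d"
  "mat2 a b c d $$ (0, Suc 0) = b"
  "mat2 a b c d $$ (Suc 0, 0) = c" "mat2 a b c d $$ (Suc 0, Suc 0) = d"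
  by (simp_all add: mat2_def mat_of_rows_list_def)

lemma mat2_carrier [simp]: "mat2 a b c d \<in> carrier_mat 2 2"
  by (simp add: mat2_def mat_of_rows_list_def numeral_2_eq_2)

lemma mat2_eq_iff:
  "mat2 a b c d = mat2 a' b' c' d' \<longleftrightarrow> a = a' \<and> b = b' \<and> c = c' \<and> d = d'"
  by (metis mat2_index(1,2,3,4))

lemma quantum_matrix_mat2:
  "quantum_matrix q q' (mat2 a b c d) \<longleftrightarrow>
     a * b = q * b * a \<and> a * c = q * c * a \<and> a * d - d * a = (q - q') * b * c \<and>
     b * c = c * b \<and> b * d = q * d * b \<and> c * d = q * d * c"
  by (auto simp: quantum_matrix_def mat2_eq_iff)


section \<open>The algebra \<open>\<A>\<^sub>q(Mat(2))\<close>\<close>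

text \<open>
  The notions above refer to an arbitrary algebra with a central unit \<open>q\<^sup>1\<^sup>/\<^sup>2\<close>. The ambient algebra
  \<open>\<A>\<^sub>q(Mat(2))\<close> over \<open>k\<close>, with \<open>q\<^sup>1\<^sup>/\<^sup>2\<close> and its inverse adjoined, is the universal one. It is
  presented as the quotient of the algebra terms in the generators by the congruence generated by
  the algebra axioms and the defining relations; no relation is imposed on \<open>q\<^sup>1\<^sup>/\<^sup>2\<close> besides being a
  central unit, so \<open>q\<close> is an indeterminate.
\<close>

datatype aq_gen = GenA | GenB | GenC | GenD | GenS | GenT

datatype 'k aq_term =
  Gen aq_gen | Const 'k | Add "'k aq_term" "'k aq_term" | Mul "'k aq_term" "'k aq_term"

abbreviation (input) aq_q :: "'k aq_term" where "aq_q \<equiv> Mul (Gen GenS) (Gen GenS)"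
abbreviation (input) aq_q' :: "'k aq_term" where "aq_q' \<equiv> Mul (Gen GenT) (Gen GenT)"
abbreviation (input) Neg :: "'k::field aq_term \<Rightarrow> 'k aq_term" where "Neg x \<equiv> Mul (Const (- 1)) x"

inductive aq_eq :: "'k::field aq_term \<Rightarrow> 'k aq_term \<Rightarrow> bool" where
  refl: "aq_eq x x"
| sym: "aq_eq x y \<Longrightarrow> aq_eq y x"
| trans: "aq_eq x y \<Longrightarrow> aq_eq y z \<Longrightarrow> aq_eq x z"
| add_cong: "aq_eq x x' \<Longrightarrow> aq_eq y y' \<Longrightarrow> aq_eq (Add x y) (Add x' y')"
| mul_cong: "aq_eq x x' \<Longrightarrow> aq_eq y y' \<Longrightarrow> aq_eq (Mul x y) (Mul x' y')"
| add_assoc: "aq_eq (Add (Add x y) z) (Add x (Add y z))"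
| add_comm: "aq_eq (Add x y) (Add y x)"
| add_zero: "aq_eq (Add (Const 0) x) x"
| zero_mul: "aq_eq (Mul (Const 0) x) (Const 0)"
| mul_assoc: "aq_eq (Mul (Mul x y) z) (Mul x (Mul y z))"
| mul_one: "aq_eq (Mul (Const 1) x) x"
| distrib_left: "aq_eq (Mul x (Add y z)) (Add (Mul x y) (Mul x z))"
| distrib_right: "aq_eq (Mul (Add x y) z) (Add (Mul x z) (Mul y z))"
| const_add: "aq_eq (Add (Const r) (Const r')) (Const (r + r'))"
| const_mul: "aq_eq (Mul (Const r) (Const r')) (Const (r * r'))"
| const_central: "aq_eq (Mul (Const r) x) (Mul x (Const r))"
| S_T: "aq_eq (Mul (Gen GenS) (Gen GenT)) (Const 1)"
| S_central: "aq_eq (Mul (Gen GenS) x) (Mul x (Gen GenS))"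
| T_central: "aq_eq (Mul (Gen GenT) x) (Mul x (Gen GenT))"
| rel_ab: "aq_eq (Mul (Gen GenA) (Gen GenB)) (Mul (Mul aq_q (Gen GenB)) (Gen GenA))"
| rel_ac: "aq_eq (Mul (Gen GenA) (Gen GenC)) (Mul (Mul aq_q (Gen GenC)) (Gen GenA))"
| rel_ad: "aq_eq (Add (Mul (Gen GenA) (Gen GenD)) (Neg (Mul (Gen GenD) (Gen GenA))))
                 (Mul (Mul (Add aq_q (Neg aq_q')) (Gen GenB)) (Gen GenC))"
| rel_bc: "aq_eq (Mul (Gen GenB) (Gen GenC)) (Mul (Gen GenC) (Gen GenB))"
| rel_bd: "aq_eq (Mul (Gen GenB) (Gen GenD)) (Mul (Mul aq_q (Gen GenD)) (Gen GenB))"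
| rel_cd: "aq_eq (Mul (Gen GenC) (Gen GenD)) (Mul (Mul aq_q (Gen GenD)) (Gen GenC))"

quotient_type (overloaded) 'k aq = "'k::field aq_term" / aq_eq
  by (rule equivpI)
    (auto intro!: reflpI sympI transpI intro: aq_eq.refl aq_eq.sym aq_eq.trans)

text \<open>The evaluation \<open>a, b, c, d \<mapsto> 0\<close>, \<open>q\<^sup>1\<^sup>/\<^sup>2 \<mapsto> 1\<close> in \<open>k\<close> shows that the quotient is nontrivial.\<close>

primrec aq_eval :: "'k::field aq_term \<Rightarrow> 'k" where
  "aq_eval (Gen g) = (if g = GenS \<or> g = GenT then 1 else 0)"
| "aq_eval (Const r) = r"
| "aq_eval (Add x y) = aq_eval x + aq_eval y"
| "aq_eval (Mul x y) = aq_eval x * aq_eval y"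

lemma aq_eval_cong: "aq_eq x y \<Longrightarrow> aq_eval x = aq_eval y"
  by (induction rule: aq_eq.induct) (simp_all add: algebra_simps)

instantiation aq :: (field) ring_1
begin

lift_definition zero_aq :: "'a aq" is "Const 0" .
lift_definition one_aq :: "'a aq" is "Const 1" .
lift_definition plus_aq :: "'a aq \<Rightarrow> 'a aq \<Rightarrow> 'a aq" is Add by (rule aq_eq.add_cong)
lift_definition times_aq :: "'a aq \<Rightarrow> 'a aq \<Rightarrow> 'a aq" is Mul by (rule aq_eq.mul_cong)
lift_definition uminus_aq :: "'a aq \<Rightarrow> 'a aq" is Neg
  by (blast intro: aq_eq.mul_cong aq_eq.refl)
lift_definition minus_aq :: "'a aq \<Rightarrow> 'a aq \<Rightarrow> 'a aq" is "\<lambda>x y. Add x (Neg y)"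
  by (blast intro: aq_eq.add_cong aq_eq.mul_cong aq_eq.refl)

instance
proof
  fix x y z :: "'a aq"
  show "x + y + z = x + (y + z)" by transfer (rule aq_eq.add_assoc)
  show "x + y = y + x" by transfer (rule aq_eq.add_comm)
  show "0 + x = x" by transfer (rule aq_eq.add_zero)
  show "x * y * z = x * (y * z)" by transfer (rule aq_eq.mul_assoc)
  show "1 * x = x" by transfer (rule aq_eq.mul_one)
  show "x * 1 = x"
    by transfer (meson aq_eq.const_central aq_eq.mul_one aq_eq.sym aq_eq.trans)
  show "(x + y) * z = x * z + y * z" by transfer (rule aq_eq.distrib_right)
  show "x * (y + z) = x * y + x * z" by transfer (rule aq_eq.distrib_left)
  show "x - y = x + - y" by transfer (rule aq_eq.refl)
  show "- x + x = 0"
  proof transfer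
    fix x :: "'a aq_term"
    have "aq_eq (Add (Neg x) x) (Add (Neg x) (Mul (Const 1) x))"
      by (intro aq_eq.add_cong aq_eq.refl aq_eq.sym[OF aq_eq.mul_one])
    moreover have "aq_eq (Add (Neg x) (Mul (Const 1) x)) (Mul (Add (Const (- 1)) (Const 1)) x)"
      by (rule aq_eq.sym[OF aq_eq.distrib_right])
    moreover have "aq_eq (Mul (Add (Const (- 1)) (Const 1)) x) (Mul (Const 0) x)"
      using aq_eq.mul_cong[OF aq_eq.const_add[of "- 1" 1] aq_eq.refl[of x]] by simp
    ultimately show "aq_eq (Add (Neg x) x) (Const 0)"
      by (blast intro: aq_eq.trans aq_eq.zero_mul)
  qed
  show "(0 :: 'a aq) \<noteq> 1" by transfer (auto dest: aq_eval_cong)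
qed

end

lift_definition aq_const :: "'k::field \<Rightarrow> 'k aq" is Const .
lift_definition aq_gen :: "aq_gen \<Rightarrow> 'k::field aq" is Gen .

abbreviation aq_scale :: "'k::field \<Rightarrow> 'k aq \<Rightarrow> 'k aq" where
  "aq_scale r x \<equiv> aq_const r * x"

lemma aq_const_simps:
  "aq_const (r + r') = aq_const r + aq_const r'"
  "aq_const (r * r') = aq_const r * aq_const r'"
  "aq_const 1 = 1"
  by (transfer, blast intro: aq_eq.sym aq_eq.const_add aq_eq.const_mul aq_eq.refl)+

lemma aq_const_central: "aq_const r * x = x * aq_const r"
  by transfer (rule aq_eq.const_central)

lemma unital_algebra_aq: "unital_algebra (aq_scale :: 'k::field \<Rightarrow> _)"
proof
  fix r :: 'k and x y :: "'k aq"
  show "x * aq_scale r y = aq_scale r (x * y)"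
    by (metis aq_const_central mult.assoc)
qed (simp_all add: aq_const_simps ring_distribs mult.assoc)

lemma central_unit_aq: "central_unit (aq_gen GenS :: 'k::field aq) (aq_gen GenT)"
proof -
  have S: "aq_gen GenS * x = x * aq_gen GenS" and T: "aq_gen GenT * x = x * aq_gen GenT"
    for x :: "'k aq"
    by (transfer, rule aq_eq.S_central aq_eq.T_central)+
  have "aq_gen GenS * aq_gen GenT = (1 :: 'k aq)"
    by transfer (rule aq_eq.S_T)
  with S T show ?thesis
    unfolding central_unit_def by metis
qed

lemma quantum_matrix_aq:
  "quantum_matrix ((aq_gen GenS)\<^sup>2) ((aq_gen GenT)\<^sup>2)
     (mat2 (aq_gen GenA) (aq_gen GenB) (aq_gen GenC) (aq_gen GenD) :: 'k::field aq mat)"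
  unfolding quantum_matrix_mat2 power2_eq_square
  by (intro conjI; transfer)
    (rule aq_eq.rel_ab aq_eq.rel_ac aq_eq.rel_ad aq_eq.rel_bc aq_eq.rel_bd aq_eq.rel_cd)+

end

theory Submission
  imports Defs
begin

text \<open>
  The closed forms come from a twisted Cayley--Hamilton identity. For an ordinary \<open>2 \<times> 2\<close> matrix,
  \<open>A\<^sup>2 = tr(A) A - det(A) I\<close>. The quantum relations give a version of this for each column \<open>j\<close> and
  each row \<open>i\<close> of \<open>A\<close>,
  \<open>(A\<^sup>2)\<^sub>k\<^sub>j = u A\<^sub>k\<^sub>j \<tau> - u\<^sup>2 I\<^sub>k\<^sub>j \<delta>\<close> and \<open>(A\<^sup>2)\<^sub>i\<^sub>k = v \<tau>' A\<^sub>i\<^sub>k - v\<^sup>2 \<delta> I\<^sub>i\<^sub>k\<close>,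
  where \<open>u\<close> is \<open>q\<^sup>-\<^sup>1\<^sup>/\<^sup>2\<close> for the first column and \<open>q\<^sup>1\<^sup>/\<^sup>2\<close> for the second, and \<open>v\<close> is
  \<open>q\<^sup>1\<^sup>/\<^sup>2\<close> for the first row and \<open>q\<^sup>-\<^sup>1\<^sup>/\<^sup>2\<close> for the second (\<open>cayley_hamilton_columns\<close>,
  \<open>cayley_hamilton_rows\<close>). Multiplication by \<open>A\<^sup>n\<close> on the left (columns) or on the right (rows) turns
  them into three-term recurrences in \<open>n\<close> for the single entries of \<open>A\<^sup>n\<close>, with \<open>\<tau>\<close> acting from the
  right or \<open>\<tau>'\<close> from the left. By Pascal's rule \<open>f\<^sub>n\<^sub>+\<^sub>1(x) = x f\<^sub>n(x) - \<delta> f\<^sub>n\<^sub>-\<^sub>1(x)\<close> (\<open>qf_rec\<close>), so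
  every solution of such a recurrence is a combination of two consecutive polynomials \<open>f\<close>. This
  yields the powers of any quantum matrix (\<open>power_columns\<close>, \<open>power_rows\<close>).

  The passage to the adjoint is a symmetry: the adjoint is a quantum matrix for \<open>q\<^sup>-\<^sup>1\<close>, with the
  same \<open>\<delta>\<close>, \<open>\<tau>\<close> and \<open>\<tau>'\<close> (\<open>adjoint_invariants\<close>). So its powers are given by the same closed forms
  with \<open>q\<^sup>1\<^sup>/\<^sup>2\<close> and \<open>q\<^sup>-\<^sup>1\<^sup>/\<^sup>2\<close> exchanged. The relations between the powers of \<open>A\<close> and of its adjoint
  are read off by comparing the column formulas, which are expressed in \<open>\<tau>\<close> for both matrices.
\<close>

section \<open>The polynomials \<open>f\<^sub>n\<close>\<close>

lemma qf_neg1 [simp]: "qf (- 1) x \<delta> = 0"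
  and qf_0 [simp]: "qf 0 x \<delta> = 1"
  by (simp_all add: qf_def)

text \<open>
  The binomial coefficient vanishes for \<open>n < 2 l\<close>, so the summation range may be enlarged; this
  removes the rounding in \<open>n div 2\<close>, which would otherwise force a parity distinction. Sign and
  binomial are merged into one integer, so that the whole coefficient commutes with everything.
\<close>

lemma qf_eq_sum_atMost:
  "qf (int n) x \<delta>
    = (\<Sum>l\<le>n. of_int ((-1) ^ l * int ((n - l) choose l)) * x ^ (n - 2 * l) * \<delta> ^ l)"
proof -
  have "(\<Sum>l = 0..n div 2. of_int ((-1) ^ l * int ((n - l) choose l)) * x ^ (n - 2 * l) * \<delta> ^ l)
      = (\<Sum>l\<le>n. of_int ((-1) ^ l * int ((n - l) choose l)) * x ^ (n - 2 * l) * \<delta> ^ l)"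
    by (rule sum.mono_neutral_left) (auto simp: binomial_eq_0)
  then show ?thesis by (simp add: qf_def)
qed

text \<open>
  Pascal's rule for the coefficients: the terms from \<open>x f\<^sub>n\<close> and \<open>- \<delta> f\<^sub>n\<^sub>-\<^sub>1\<close> with the same monomial
  add up to one term of \<open>f\<^sub>n\<^sub>+\<^sub>1\<close>, the latter after a shift of the summation index.
\<close>

lemma qf_rec:
  fixes x \<delta> :: "'r::ring_1"
  assumes comm: "x * \<delta> = \<delta> * x"
  shows "qf (int n + 1) x \<delta> = x * qf (int n) x \<delta> - \<delta> * qf (int n - 1) x \<delta>"
proof (cases n)
  case 0
  then show ?thesis by (simp add: qf_def)
next
  case (Suc k)
  define coeff where "coeff n l = (-1) ^ l * int ((n - l) choose l)" for n l
  define g where "g n l = of_int (coeff n l) * x ^ (n - 2 * l) * \<delta> ^ l" for n l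
  have g_0: "g (Suc (Suc k)) 0 = x * g (Suc k) 0"
    by (simp add: g_def coeff_def)
  have g_Suc: "g (Suc (Suc k)) (Suc l) = x * g (Suc k) (Suc l) - \<delta> * g k l" if "l \<le> k" for l
  proof -
    have pull: "y * (of_int i * z) = of_int i * (y * z)" for i and y z :: 'r
      by (metis mult.assoc mult_of_int_commute)
    have pascal: "coeff (Suc (Suc k)) (Suc l) = coeff (Suc k) (Suc l) - coeff k l"
      using that by (simp add: coeff_def Suc_diff_le algebra_simps)
    have \<delta>_term: "\<delta> * g k l = of_int (coeff k l) * (x ^ (k - 2 * l) * \<delta> ^ Suc l)"
    proof -
      have "\<delta> * x ^ (k - 2 * l) = x ^ (k - 2 * l) * \<delta>"
        by (metis comm power_commuting_commutes)
      then have "\<delta> * (x ^ (k - 2 * l) * \<delta> ^ l) = x ^ (k - 2 * l) * \<delta> ^ Suc l"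
        by (simp flip: mult.assoc)
      then show ?thesis
        by (simp add: g_def mult.assoc pull)
    qed
    have x_term: "x * g (Suc k) (Suc l) = of_int (coeff (Suc k) (Suc l)) * (x ^ (k - 2 * l) * \<delta> ^ Suc l)"
    proof (cases "2 * l < k")
      case True
      then have "k - 2 * l = Suc (Suc k - 2 * Suc l)" by simp
      then have "x * (x ^ (Suc k - 2 * Suc l) * \<delta> ^ Suc l) = x ^ (k - 2 * l) * \<delta> ^ Suc l"
        by (simp only: power_Suc mult.assoc)
      then show ?thesis
        by (simp only: g_def mult.assoc pull)
    next
      \<comment> \<open>Here the exponent of \<open>x\<close> on the left may be truncated, but the coefficient is zero.\<close>
      case False
      then show ?thesis by (simp add: g_def coeff_def binomial_eq_0)
    qed
    have "g (Suc (Suc k)) (Suc l) = of_int (coeff (Suc (Suc k)) (Suc l)) * (x ^ (k - 2 * l) * \<delta> ^ Suc l)"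
      by (simp add: g_def mult.assoc)
    then show ?thesis
      unfolding pascal x_term \<delta>_term by (simp add: left_diff_distrib)
  qed
  have qf_g: "qf (int n) x \<delta> = (\<Sum>l\<le>n. g n l)" for n
    unfolding g_def coeff_def by (rule qf_eq_sum_atMost)
  have "qf (int n + 1) x \<delta> = (\<Sum>l\<le>Suc (Suc k). g (Suc (Suc k)) l)"
    using qf_g[of "Suc (Suc k)"] Suc by (simp add: add.commute)
  also have "\<dots> = (\<Sum>l\<le>Suc k. g (Suc (Suc k)) l)"
    by (simp add: g_def coeff_def binomial_eq_0)
  also have "\<dots> = x * g (Suc k) 0 + (\<Sum>l\<le>k. x * g (Suc k) (Suc l) - \<delta> * g k l)"
    by (subst sum.atMost_Suc_shift) (simp add: g_0 g_Suc)
  also have "\<dots> = x * (\<Sum>l\<le>Suc k. g (Suc k) l) - \<delta> * (\<Sum>l\<le>k. g k l)"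
    by (simp only: sum.atMost_Suc_shift ring_distribs sum_distrib_left sum_subtractf add_diff_eq)
  also have "\<dots> = x * qf (int n) x \<delta> - \<delta> * qf (int n - 1) x \<delta>"
    using qf_g[of "Suc k"] qf_g[of k] Suc by simp
  finally show ?thesis .
qed

lemma qf_commute:
  fixes x \<delta> y :: "'r::ring_1"
  assumes "y * x = x * y" and "y * \<delta> = \<delta> * y"
  shows "y * qf n x \<delta> = qf n x \<delta> * y"
proof -
  have y_pow: "y * x ^ i = x ^ i * y" "y * \<delta> ^ j = \<delta> ^ j * y" for i j
    by (metis assms power_commuting_commutes)+
  have y_coeff: "y * ((-1) ^ i * of_nat j) = (-1) ^ i * of_nat j * y" for i j
    by (cases "even i") (simp_all add: mult_of_nat_commute)
  have "y * ((-1) ^ i * of_nat j * x ^ k * \<delta> ^ l) = (-1) ^ i * of_nat j * x ^ k * \<delta> ^ l * y"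
    for i j k l
    by (metis y_pow y_coeff mult.assoc)
  then show ?thesis
    by (simp add: qf_def sum_distrib_left sum_distrib_right)
qed

section \<open>Three-term recurrences\<close>

text \<open>
  The powers of \<open>u\<close> rescale the recurrence \<open>f\<^sub>n\<^sub>+\<^sub>1 = x f\<^sub>n - \<delta> f\<^sub>n\<^sub>-\<^sub>1\<close>. The parameter \<open>\<delta>\<close> is
  required to commute with \<open>x\<close> only, so it has to stay on the same side as \<open>x\<close>. For quantum matrices
  over an arbitrary ring this is the right generality: there \<open>\<delta>\<close> commutes with the entries, but
  need not be central.
\<close>

lemma right_recurrence_solution:
  fixes X :: "nat \<Rightarrow> 'r::ring_1"
  assumes u: "\<And>y. u * y = y * u" and comm: "x * \<delta> = \<delta> * x"
    and rec: "\<And>n. X (Suc (Suc n)) = u * X (Suc n) * x - u\<^sup>2 * X n * \<delta>"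
  shows "X (Suc n)
      = u ^ n * X 1 * qf (int n) x \<delta> - u ^ Suc n * X 0 * \<delta> * qf (int n - 1) x \<delta>"
proof -
  define G where "G n = qf (int n - 1) x \<delta>" for n
  have G: "G 0 = 0" "G (Suc 0) = 1" "G (Suc (Suc n)) = x * G (Suc n) - \<delta> * G n" for n
    using qf_rec[OF comm, of n] by (simp_all add: G_def add.commute)
  have Gx: "G n * x = x * G n" and G\<delta>: "G n * \<delta> = \<delta> * G n" for n
    unfolding G_def by (simp_all add: qf_commute comm)
  have comm_left: "x * (\<delta> * z) = \<delta> * (x * z)" for z
    by (metis comm mult.assoc)
  have "X (Suc n) = u ^ n * (X 1 * G (Suc n)) - u ^ Suc n * (X 0 * (\<delta> * G n))"
  proof (induction n rule: induct_nat_012)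
    case 0
    show ?case by (simp add: G)
  next
    case 1
    show ?case by (simp add: rec G power2_eq_square mult.assoc)
  next
    case (ge2 n)
    show ?case
      unfolding rec[of "Suc n"] ge2
      by (simp add: G Gx G\<delta> comm_left power2_eq_square ring_distribs mult.assoc)
  qed
  then show ?thesis by (simp add: G_def mult.assoc)
qed

lemma left_recurrence_solution:
  fixes X :: "nat \<Rightarrow> 'r::ring_1"
  assumes u: "\<And>y. u * y = y * u" and comm: "x * \<delta> = \<delta> * x"
    and rec: "\<And>n. X (Suc (Suc n)) = u * x * X (Suc n) - u\<^sup>2 * \<delta> * X n"
  shows "X (Suc n)
      = u ^ n * qf (int n) x \<delta> * X 1 - u ^ Suc n * \<delta> * qf (int n - 1) x \<delta> * X 0"
proof -
  define G where "G n = qf (int n - 1) x \<delta>" for n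
  have G: "G 0 = 0" "G (Suc 0) = 1" "G (Suc (Suc n)) = x * G (Suc n) - \<delta> * G n" for n
    using qf_rec[OF comm, of n] by (simp_all add: G_def add.commute)
  have comm_left: "x * (\<delta> * z) = \<delta> * (x * z)" for z
    by (metis comm mult.assoc)
  have u_left: "y * (u ^ n * z) = u ^ n * (y * z)" for y n z
    by (metis u power_commuting_commutes mult.assoc)
  \<comment> \<open>As a rewrite rule this would loop at \<open>y = u\<close>, so only its instances are used.\<close>
  note u_left = u_left[of x] u_left[of \<delta>] u_left[of x 1, simplified] u_left[of \<delta> 1, simplified]
  have "X (Suc n) = u ^ n * (G (Suc n) * X 1) - u ^ Suc n * (\<delta> * (G n * X 0))"
  proof (induction n rule: induct_nat_012)
    case 0
    show ?case by (simp add: G)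
  next
    case 1
    show ?case by (simp add: rec G power2_eq_square mult.assoc)
  next
    case (ge2 n)
    show ?case
      unfolding rec[of "Suc n"] ge2
      by (simp add: G comm_left power2_eq_square u_left ring_distribs mult.assoc)
  qed
  then show ?thesis by (simp add: G_def mult.assoc)
qed

section \<open>Powers of quantum matrices\<close>

lemma less_2_sum: "sum f {0..<2::nat} = f 0 + f 1"
  by (simp add: numeral_2_eq_2)

lemma mat2_dim [simp]: "dim_row (mat2 a b c d) = 2" "dim_col (mat2 a b c d) = 2"
  using mat2_carrier[of a b c d] by blast+

lemma mult_mat2_index:
  assumes "M \<in> carrier_mat 2 2" and "i < 2"
  shows "(M * mat2 a b c d) $$ (i, 0) = M $$ (i, 0) * a + M $$ (i, 1) * c"
    and "(M * mat2 a b c d) $$ (i, 1) = M $$ (i, 0) * b + M $$ (i, 1) * d"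
  using assms by (auto simp: scalar_prod_def less_2_sum)

lemma mat2_mult_index:
  assumes "M \<in> carrier_mat 2 2" and "j < 2"
  shows "(mat2 a b c d * M) $$ (0, j) = a * M $$ (0, j) + b * M $$ (1, j)"
    and "(mat2 a b c d * M) $$ (1, j) = c * M $$ (0, j) + d * M $$ (1, j)"
  using assms by (auto simp: scalar_prod_def less_2_sum)

lemma pow_mat_Suc_left:
  assumes "M \<in> carrier_mat n n"
  shows "M ^\<^sub>m Suc k = M * M ^\<^sub>m k"
proof (induction k)
  case (Suc k)
  then show ?case
    using assms assoc_mult_mat[OF assms pow_carrier_mat[OF assms] assms, of k] by simp
qed (use assms in simp)

text \<open>
  Here \<open>s = q\<^sup>1\<^sup>/\<^sup>2\<close> and \<open>t = q\<^sup>-\<^sup>1\<^sup>/\<^sup>2\<close>. Both are parameters, so that replacing \<open>q\<close> by \<open>q\<^sup>-\<^sup>1\<close> is an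
  instance of the locale.
\<close>

locale quantum_matrix_entries =
  fixes s t a b c d :: "'r::ring_1"
  assumes central_unit: "central_unit s t"
    and quantum: "quantum_matrix (s\<^sup>2) (t\<^sup>2) (mat2 a b c d)"
begin

definition "\<delta> = a * d - s\<^sup>2 * b * c"
definition "\<tau> = s * a + t * d"
definition "\<tau>' = t * a + s * d"

lemma st: "s * t = 1" "t * s = 1"
  and s_central: "s * x = x * s" and t_central: "t * x = x * t"
  using central_unit unfolding central_unit_def by blast+

lemma st_left: "s * (t * x) = x" "t * (s * x) = x"
  by (simp_all add: st flip: mult.assoc)

lemma central_left: "x * (s * y) = s * (x * y)" "x * (t * y) = t * (x * y)"
  by (simp_all add: s_central[of x] t_central[of x] flip: mult.assoc)

text \<open>As a rewrite rule, \<open>central_left\<close> loops when \<open>x\<close> is itself a scalar; these instances do not.\<close>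

lemmas entries_central_left =
  central_left[of a] central_left[of b] central_left[of c] central_left[of d]

text \<open>
  Oriented as rewrite rules, the defining relations bring every word in the generators into the
  order \<open>d, b, c, a\<close>, with the scalars in front. Identities between
  polynomials in the entries are proved below by normalizing both sides.
\<close>

lemma ordering:
  "a * b = s * (s * (b * a))" "a * c = s * (s * (c * a))"
  "a * d = d * a + (s * (s * (b * c)) - t * (t * (b * c)))"
  "c * b = b * c" "b * d = s * (s * (d * b))" "c * d = s * (s * (d * c))"
proof -
  note rels = quantum[unfolded quantum_matrix_mat2]
  show "a * b = s * (s * (b * a))" "a * c = s * (s * (c * a))"
    "b * d = s * (s * (d * b))" "c * d = s * (s * (d * c))"
    using rels by (simp_all add: power2_eq_square mult.assoc)
  show "c * b = b * c" using rels by simp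
  have "a * d = d * a + (s\<^sup>2 - t\<^sup>2) * b * c"
    using rels by (simp add: diff_eq_eq add.commute)
  then show "a * d = d * a + (s * (s * (b * c)) - t * (t * (b * c)))"
    by (simp only: power2_eq_square ring_distribs mult.assoc)
qed

lemma ordering_left:
  "a * (b * x) = s * (s * (b * (a * x)))" "a * (c * x) = s * (s * (c * (a * x)))"
  "a * (d * x) = d * (a * x) + (s * (s * (b * (c * x))) - t * (t * (b * (c * x))))"
  "c * (b * x) = b * (c * x)" "b * (d * x) = s * (s * (d * (b * x)))"
  "c * (d * x) = s * (s * (d * (c * x)))"
proof -
  show "a * (b * x) = s * (s * (b * (a * x)))"
    by (simp add: ordering(1) flip: mult.assoc)
  show "a * (c * x) = s * (s * (c * (a * x)))"
    by (simp add: ordering(2) flip: mult.assoc)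
  have "a * d * x = (d * a + (s * (s * (b * c)) - t * (t * (b * c)))) * x"
    by (simp only: ordering(3))
  then show "a * (d * x) = d * (a * x) + (s * (s * (b * (c * x))) - t * (t * (b * (c * x))))"
    by (simp only: ring_distribs mult.assoc)
  show "c * (b * x) = b * (c * x)"
    by (simp add: ordering(4) flip: mult.assoc)
  show "b * (d * x) = s * (s * (d * (b * x)))"
    by (simp add: ordering(5) flip: mult.assoc)
  show "c * (d * x) = s * (s * (d * (c * x)))"
    by (simp add: ordering(6) flip: mult.assoc)
qed

lemma scalars_to_front:
  "a * s = s * a" "b * s = s * b" "c * s = s * c" "d * s = s * d" "t * s = 1"
  "a * t = t * a" "b * t = t * b" "c * t = t * c" "d * t = t * d" "s * t = 1"
  by (simp_all only: st s_central[of a] s_central[of b] s_central[of c] s_central[of d]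
      t_central[of a] t_central[of b] t_central[of c] t_central[of d])

lemmas normalize = power2_eq_square mult.assoc ring_distribs st_left entries_central_left
  scalars_to_front ordering ordering_left

text \<open>This is the centrality of the quantum determinant, as far as the recurrences need it.\<close>

lemma \<delta>_commute: "\<tau> * \<delta> = \<delta> * \<tau>" "\<tau>' * \<delta> = \<delta> * \<tau>'"
proof -
  have "a * \<delta> = \<delta> * a" "d * \<delta> = \<delta> * d"
    by (simp_all add: \<delta>_def normalize algebra_simps)
  then show "\<tau> * \<delta> = \<delta> * \<tau>" "\<tau>' * \<delta> = \<delta> * \<tau>'"
    by (simp_all add: \<tau>_def \<tau>'_def ring_distribs mult.assoc central_left[of \<delta>])
qed

text \<open>
  The left hand sides are the entries of \<open>A\<^sup>2\<close>. The factor \<open>t\<close> of the first column is forced by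
  \<open>a \<tau> = s (a\<^sup>2 + q\<^sup>-\<^sup>1 a d)\<close>: multiplied by \<open>t\<close>, it has leading term \<open>a\<^sup>2\<close>, and the rest
  \<open>q\<^sup>-\<^sup>1 a d\<close> is \<open>q\<^sup>-\<^sup>1 \<delta> + b c\<close>. In the second column \<open>d\<close> is weighted by \<open>t\<close> in \<open>\<tau>\<close>, which forces
  the factor \<open>s\<close>.
\<close>

lemma cayley_hamilton_columns:
  "a * a + b * c = t * a * \<tau> - t\<^sup>2 * \<delta>" "c * a + d * c = t * c * \<tau>"
  "a * b + b * d = s * b * \<tau>" "c * b + d * d = s * d * \<tau> - s\<^sup>2 * \<delta>"
  by (simp_all add: \<delta>_def \<tau>_def normalize algebra_simps)

lemma cayley_hamilton_rows:
  "a * a + b * c = s * \<tau>' * a - s\<^sup>2 * \<delta>" "a * b + b * d = s * \<tau>' * b"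
  "c * a + d * c = t * \<tau>' * c" "c * b + d * d = t * \<tau>' * d - t\<^sup>2 * \<delta>"
  by (simp_all add: \<delta>_def \<tau>'_def normalize algebra_simps)

abbreviation "A \<equiv> mat2 a b c d"

lemma power_Suc_index:
  assumes "i < 2"
  shows "(A ^\<^sub>m Suc n) $$ (i, 0) = (A ^\<^sub>m n) $$ (i, 0) * a + (A ^\<^sub>m n) $$ (i, 1) * c"
    and "(A ^\<^sub>m Suc n) $$ (i, 1) = (A ^\<^sub>m n) $$ (i, 0) * b + (A ^\<^sub>m n) $$ (i, 1) * d"
  by (simp_all only: pow_mat.simps mult_mat2_index[OF pow_carrier_mat[OF mat2_carrier] assms])

lemma power_Suc_index_left:
  assumes "j < 2"
  shows "(A ^\<^sub>m Suc n) $$ (0, j) = a * (A ^\<^sub>m n) $$ (0, j) + b * (A ^\<^sub>m n) $$ (1, j)"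
    and "(A ^\<^sub>m Suc n) $$ (1, j) = c * (A ^\<^sub>m n) $$ (0, j) + d * (A ^\<^sub>m n) $$ (1, j)"
  by (simp_all only: pow_mat_Suc_left[OF mat2_carrier]
      mat2_mult_index[OF pow_carrier_mat[OF mat2_carrier] assms])

lemma power_0_index:
  "(A ^\<^sub>m 0) $$ (0, 0) = 1" "(A ^\<^sub>m 0) $$ (0, 1) = 0"
  "(A ^\<^sub>m 0) $$ (1, 0) = 0" "(A ^\<^sub>m 0) $$ (1, 1) = 1"
  by simp_all

lemma power_1: "A ^\<^sub>m 1 = A"
  using left_mult_one_mat[OF mat2_carrier] by simp

text \<open>
  The column version multiplies from the left by \<open>A\<^sup>n\<close>, so that \<open>\<tau>\<close> and \<open>\<delta>\<close> stay outermost on the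
  right and need not be moved past the entries of \<open>A\<^sup>n\<close>. The row version is its mirror image.
\<close>

lemma power_column_recurrence:
  assumes "i < 2"
  shows "(A ^\<^sub>m Suc (Suc n)) $$ (i, 0)
      = t * (A ^\<^sub>m Suc n) $$ (i, 0) * \<tau> - t\<^sup>2 * (A ^\<^sub>m n) $$ (i, 0) * \<delta>"
    and "(A ^\<^sub>m Suc (Suc n)) $$ (i, 1)
      = s * (A ^\<^sub>m Suc n) $$ (i, 1) * \<tau> - s\<^sup>2 * (A ^\<^sub>m n) $$ (i, 1) * \<delta>"
proof -
  define x y where "x = (A ^\<^sub>m n) $$ (i, 0)" and "y = (A ^\<^sub>m n) $$ (i, 1)"
  note index = power_Suc_index[OF assms] x_def[symmetric] y_def[symmetric]
  have "(x * a + y * c) * a + (x * b + y * d) * c = x * (a * a + b * c) + y * (c * a + d * c)"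
    and "(x * a + y * c) * b + (x * b + y * d) * d = x * (a * b + b * d) + y * (c * b + d * d)"
    by (simp_all add: algebra_simps)
  then show "(A ^\<^sub>m Suc (Suc n)) $$ (i, 0)
      = t * (A ^\<^sub>m Suc n) $$ (i, 0) * \<tau> - t\<^sup>2 * (A ^\<^sub>m n) $$ (i, 0) * \<delta>"
    and "(A ^\<^sub>m Suc (Suc n)) $$ (i, 1)
      = s * (A ^\<^sub>m Suc n) $$ (i, 1) * \<tau> - s\<^sup>2 * (A ^\<^sub>m n) $$ (i, 1) * \<delta>"
    unfolding index cayley_hamilton_columns
    by (simp_all add: power2_eq_square ring_distribs mult.assoc central_left[of x] central_left[of y])
qed

lemma power_row_recurrence:
  assumes "j < 2"
  shows "(A ^\<^sub>m Suc (Suc n)) $$ (0, j)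
      = s * \<tau>' * (A ^\<^sub>m Suc n) $$ (0, j) - s\<^sup>2 * \<delta> * (A ^\<^sub>m n) $$ (0, j)"
    and "(A ^\<^sub>m Suc (Suc n)) $$ (1, j)
      = t * \<tau>' * (A ^\<^sub>m Suc n) $$ (1, j) - t\<^sup>2 * \<delta> * (A ^\<^sub>m n) $$ (1, j)"
proof -
  define x y where "x = (A ^\<^sub>m n) $$ (0, j)" and "y = (A ^\<^sub>m n) $$ (1, j)"
  note index = power_Suc_index_left[OF assms] x_def[symmetric] y_def[symmetric]
  have "a * (a * x + b * y) + b * (c * x + d * y) = (a * a + b * c) * x + (a * b + b * d) * y"
    and "c * (a * x + b * y) + d * (c * x + d * y) = (c * a + d * c) * x + (c * b + d * d) * y"
    by (simp_all add: algebra_simps)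
  then show "(A ^\<^sub>m Suc (Suc n)) $$ (0, j)
      = s * \<tau>' * (A ^\<^sub>m Suc n) $$ (0, j) - s\<^sup>2 * \<delta> * (A ^\<^sub>m n) $$ (0, j)"
    and "(A ^\<^sub>m Suc (Suc n)) $$ (1, j)
      = t * \<tau>' * (A ^\<^sub>m Suc n) $$ (1, j) - t\<^sup>2 * \<delta> * (A ^\<^sub>m n) $$ (1, j)"
    unfolding index cayley_hamilton_rows
    by (simp_all add: ring_distribs mult.assoc)
qed

lemma power_columns:
  "(A ^\<^sub>m Suc n) $$ (0, 0) = t ^ n * a * qf (int n) \<tau> \<delta> - t ^ Suc n * \<delta> * qf (int n - 1) \<tau> \<delta>"
  "(A ^\<^sub>m Suc n) $$ (0, 1) = s ^ n * b * qf (int n) \<tau> \<delta>"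
  "(A ^\<^sub>m Suc n) $$ (1, 0) = t ^ n * c * qf (int n) \<tau> \<delta>"
  "(A ^\<^sub>m Suc n) $$ (1, 1) = s ^ n * d * qf (int n) \<tau> \<delta> - s ^ Suc n * \<delta> * qf (int n - 1) \<tau> \<delta>"
proof -
  have "(A ^\<^sub>m Suc n) $$ (i, 0) = t ^ n * (A ^\<^sub>m 1) $$ (i, 0) * qf (int n) \<tau> \<delta>
      - t ^ Suc n * (A ^\<^sub>m 0) $$ (i, 0) * \<delta> * qf (int n - 1) \<tau> \<delta>"
    and "(A ^\<^sub>m Suc n) $$ (i, 1) = s ^ n * (A ^\<^sub>m 1) $$ (i, 1) * qf (int n) \<tau> \<delta>
      - s ^ Suc n * (A ^\<^sub>m 0) $$ (i, 1) * \<delta> * qf (int n - 1) \<tau> \<delta>" if "i < 2" for i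
    by (rule right_recurrence_solution[where X = "\<lambda>n. (A ^\<^sub>m n) $$ (i, _)"];
        rule s_central t_central \<delta>_commute power_column_recurrence[OF that])+
  from this[of 0] this[of 1] show
    "(A ^\<^sub>m Suc n) $$ (0, 0) = t ^ n * a * qf (int n) \<tau> \<delta> - t ^ Suc n * \<delta> * qf (int n - 1) \<tau> \<delta>"
    "(A ^\<^sub>m Suc n) $$ (0, 1) = s ^ n * b * qf (int n) \<tau> \<delta>"
    "(A ^\<^sub>m Suc n) $$ (1, 0) = t ^ n * c * qf (int n) \<tau> \<delta>"
    "(A ^\<^sub>m Suc n) $$ (1, 1) = s ^ n * d * qf (int n) \<tau> \<delta> - s ^ Suc n * \<delta> * qf (int n - 1) \<tau> \<delta>"
    unfolding power_0_index power_1 mat2_index by simp_all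
qed

lemma power_rows:
  "(A ^\<^sub>m Suc n) $$ (0, 0) = s ^ n * qf (int n) \<tau>' \<delta> * a - s ^ Suc n * \<delta> * qf (int n - 1) \<tau>' \<delta>"
  "(A ^\<^sub>m Suc n) $$ (0, 1) = s ^ n * qf (int n) \<tau>' \<delta> * b"
  "(A ^\<^sub>m Suc n) $$ (1, 0) = t ^ n * qf (int n) \<tau>' \<delta> * c"
  "(A ^\<^sub>m Suc n) $$ (1, 1) = t ^ n * qf (int n) \<tau>' \<delta> * d - t ^ Suc n * \<delta> * qf (int n - 1) \<tau>' \<delta>"
proof -
  have "(A ^\<^sub>m Suc n) $$ (0, j) = s ^ n * qf (int n) \<tau>' \<delta> * (A ^\<^sub>m 1) $$ (0, j)
      - s ^ Suc n * \<delta> * qf (int n - 1) \<tau>' \<delta> * (A ^\<^sub>m 0) $$ (0, j)"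
    and "(A ^\<^sub>m Suc n) $$ (1, j) = t ^ n * qf (int n) \<tau>' \<delta> * (A ^\<^sub>m 1) $$ (1, j)
      - t ^ Suc n * \<delta> * qf (int n - 1) \<tau>' \<delta> * (A ^\<^sub>m 0) $$ (1, j)" if "j < 2" for j
    by (rule left_recurrence_solution[where X = "\<lambda>n. (A ^\<^sub>m n) $$ (_, j)"];
        rule s_central t_central \<delta>_commute power_row_recurrence[OF that])+
  from this[of 0] this[of 1] show
    "(A ^\<^sub>m Suc n) $$ (0, 0) = s ^ n * qf (int n) \<tau>' \<delta> * a - s ^ Suc n * \<delta> * qf (int n - 1) \<tau>' \<delta>"
    "(A ^\<^sub>m Suc n) $$ (0, 1) = s ^ n * qf (int n) \<tau>' \<delta> * b"
    "(A ^\<^sub>m Suc n) $$ (1, 0) = t ^ n * qf (int n) \<tau>' \<delta> * c"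
    "(A ^\<^sub>m Suc n) $$ (1, 1) = t ^ n * qf (int n) \<tau>' \<delta> * d - t ^ Suc n * \<delta> * qf (int n - 1) \<tau>' \<delta>"
    unfolding power_0_index power_1 mat2_index by simp_all
qed

text \<open>
  The adjoint matrix is a quantum matrix with \<open>q\<close> replaced by \<open>q\<^sup>-\<^sup>1\<close>, since exchanging \<open>a\<close> and \<open>d\<close>
  turns each defining relation into the one for the inverse parameter, and the scalar factors
  of the two other entries cancel in their product. The same exchange combined
  with that of \<open>s\<close> and \<open>t\<close> leaves \<open>\<tau> = s a + t d\<close> and \<open>\<tau>' = t a + s d\<close> unchanged, and \<open>\<delta>\<close> is
  recovered in its second form \<open>d a - q\<^sup>-\<^sup>1 b c\<close>.
\<close>

lemma adjoint_quantum_matrix_entries: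
  "quantum_matrix_entries t s d (- (t\<^sup>2 * b)) (- (s\<^sup>2 * c)) a"
proof
  show "central_unit t s" using central_unit unfolding central_unit_def by blast
  show "quantum_matrix (t\<^sup>2) (s\<^sup>2) (mat2 d (- (t\<^sup>2 * b)) (- (s\<^sup>2 * c)) a)"
    unfolding quantum_matrix_mat2 by (simp add: normalize)
qed

lemma adjoint_invariants:
  "quantum_matrix_entries.\<delta> t d (- (t\<^sup>2 * b)) (- (s\<^sup>2 * c)) a = \<delta>"
  "quantum_matrix_entries.\<tau> t s d a = \<tau>"
  "quantum_matrix_entries.\<tau>' t s d a = \<tau>'"
  unfolding quantum_matrix_entries.\<delta>_def[OF adjoint_quantum_matrix_entries] \<delta>_def
    quantum_matrix_entries.\<tau>_def[OF adjoint_quantum_matrix_entries] \<tau>_def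
    quantum_matrix_entries.\<tau>'_def[OF adjoint_quantum_matrix_entries] \<tau>'_def
  by (simp_all add: normalize add.commute)

lemmas adjoint_power_columns =
  quantum_matrix_entries.power_columns[OF adjoint_quantum_matrix_entries, unfolded adjoint_invariants]

lemmas adjoint_power_rows =
  quantum_matrix_entries.power_rows[OF adjoint_quantum_matrix_entries, unfolded adjoint_invariants]

end

theorem corollary1p3:
  fixes scale :: "'k::field \<Rightarrow> 'r::ring_1 \<Rightarrow> 'r"
    and s t q q' a b c d ah bh ch dh \<delta> \<tau> \<tau>' :: 'r
    and A Ah :: "'r mat"
    and m :: nat
  assumes "unital_algebra scale"
    and "central_unit s t"
    and "q = s\<^sup>2" and "q' = t\<^sup>2"
    and "A = mat2 a b c d"
    and "quantum_matrix q q' A"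
    and "Ah = mat2 ah bh ch dh"
    and "ah = d" and "bh = - (q' * b)" and "ch = - (q * c)" and "dh = a"
    and "\<delta> = a * d - q * b * c"
    and "\<tau> = s * a + t * d"
    and "\<tau>' = t * a + s * d"
    and "m \<ge> 1"
  shows
    "((Ah ^\<^sub>m m) $$ (0, 0)
        = s ^ (m - 1) * ah * qf (int m - 1) \<tau> \<delta> - s ^ m * \<delta> * qf (int m - 2) \<tau> \<delta>
      \<and> (Ah ^\<^sub>m m) $$ (0, 0)
        = t ^ (m - 1) * qf (int m - 1) \<tau>' \<delta> * ah - t ^ m * \<delta> * qf (int m - 2) \<tau>' \<delta>
      \<and> (Ah ^\<^sub>m m) $$ (0, 0) = (A ^\<^sub>m m) $$ (1, 1))
   \<and> ((Ah ^\<^sub>m m) $$ (0, 1) = t ^ (m - 1) * bh * qf (int m - 1) \<tau> \<delta>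
      \<and> (Ah ^\<^sub>m m) $$ (0, 1) = t ^ (m - 1) * qf (int m - 1) \<tau>' \<delta> * bh
      \<and> (Ah ^\<^sub>m m) $$ (0, 1) = - (q' ^ m) * (A ^\<^sub>m m) $$ (0, 1))
   \<and> ((Ah ^\<^sub>m m) $$ (1, 0) = s ^ (m - 1) * ch * qf (int m - 1) \<tau> \<delta>
      \<and> (Ah ^\<^sub>m m) $$ (1, 0) = s ^ (m - 1) * qf (int m - 1) \<tau>' \<delta> * ch
      \<and> (Ah ^\<^sub>m m) $$ (1, 0) = - (q ^ m) * (A ^\<^sub>m m) $$ (1, 0))
   \<and> ((Ah ^\<^sub>m m) $$ (1, 1)
        = t ^ (m - 1) * dh * qf (int m - 1) \<tau> \<delta> - t ^ m * \<delta> * qf (int m - 2) \<tau> \<delta>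
      \<and> (Ah ^\<^sub>m m) $$ (1, 1)
        = s ^ (m - 1) * qf (int m - 1) \<tau>' \<delta> * dh - s ^ m * \<delta> * qf (int m - 2) \<tau>' \<delta>
      \<and> (Ah ^\<^sub>m m) $$ (1, 1) = (A ^\<^sub>m m) $$ (0, 0))"
proof -
  interpret Q: quantum_matrix_entries s t a b c d
    using assms by unfold_locales simp_all
  have \<delta>: "\<delta> = Q.\<delta>" and \<tau>: "\<tau> = Q.\<tau>" and \<tau>': "\<tau>' = Q.\<tau>'"
    by (simp_all only: assms Q.\<delta>_def Q.\<tau>_def Q.\<tau>'_def)
  have A: "A = mat2 a b c d" and Ah: "Ah = mat2 d (- (t\<^sup>2 * b)) (- (s\<^sup>2 * c)) a"
    and bh: "bh = - (t\<^sup>2 * b)" and ch: "ch = - (s\<^sup>2 * c)"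
    by (simp_all only: assms)
  obtain n where m: "m = Suc n"
    using \<open>m \<ge> 1\<close> by (cases m) auto
  have index: "m - 1 = n" "int m - 1 = int n" "int m - 2 = int n - 1"
    by (simp_all add: m)
  have double: "(x\<^sup>2) ^ Suc n = x ^ n * x\<^sup>2 * x ^ n" for x :: 'r
    by (simp only: flip: power_mult power_add) (rule arg_cong[where f = "\<lambda>k. x ^ k"], simp)
  \<comment> \<open>The upper right entries carry the factor \<open>q\<^sup>n\<^sup>/\<^sup>2\<close> in \<open>A\<^sup>m\<close> and \<open>q\<^sup>-\<^sup>n\<^sup>/\<^sup>2\<close> in the power of the
    adjoint. Together with the coefficient \<open>q\<^sup>-\<^sup>1\<close> in the adjoint itself, the ratio is
    \<open>- q\<^sup>-\<^sup>n\<^sup>-\<^sup>1\<close>. For the lower left entries all exponents change sign.\<close>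
  have b_scaling: "t ^ n * - (t\<^sup>2 * b) * y = - (q' ^ m) * (s ^ n * b * y)" for y
  proof -
    have "q' ^ m * s ^ n = t ^ n * t\<^sup>2"
      using left_right_inverse_power[OF Q.st(2), of n]
      by (simp only: \<open>q' = t\<^sup>2\<close> m double mult.assoc mult_1_right)
    then show ?thesis by (simp flip: mult.assoc)
  qed
  have c_scaling: "s ^ n * - (s\<^sup>2 * c) * y = - (q ^ m) * (t ^ n * c * y)" for y
  proof -
    have "q ^ m * t ^ n = s ^ n * s\<^sup>2"
      using left_right_inverse_power[OF Q.st(1), of n]
      by (simp only: \<open>q = s\<^sup>2\<close> m double mult.assoc mult_1_right)
    then show ?thesis by (simp flip: mult.assoc)
  qed
  have comparison:
    "(Ah ^\<^sub>m m) $$ (0, 0) = (A ^\<^sub>m m) $$ (1, 1)"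
    "(Ah ^\<^sub>m m) $$ (0, 1) = - (q' ^ m) * (A ^\<^sub>m m) $$ (0, 1)"
    "(Ah ^\<^sub>m m) $$ (1, 0) = - (q ^ m) * (A ^\<^sub>m m) $$ (1, 0)"
    "(Ah ^\<^sub>m m) $$ (1, 1) = (A ^\<^sub>m m) $$ (0, 0)"
    unfolding A Ah m Q.adjoint_power_columns Q.power_columns
    by (simp_all only: b_scaling c_scaling flip: m)
  show ?thesis
    unfolding comparison[symmetric] index
    unfolding Ah m \<delta> \<tau> \<tau>' bh ch \<open>ah = d\<close> \<open>dh = a\<close>
    by (intro conjI HOL.refl Q.adjoint_power_columns Q.adjoint_power_rows)
qed

end
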